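(* Let $0<\alpha<1$ and let $p_1,\dots,p_n$ be $p$-values with arbitrary joint distribution, of which $n_0$ are null; put $\pi_0=n_0/n$ and $S(n_0)=1+\frac12+\cdots+\frac1{n_0}$. Then any procedure that is compliant at level $\alpha$ satisfies $$\mathrm{FDR}\le\begin{cases}1,&\text{if }\alpha\ge\dfrac1{\pi_0S(n_0)},\\[2mm] S(n_0)\,\pi_0\,\alpha\,\log\dfrac{e}{S(n_0)\,\pi_0\,\alpha},&\text{if }\alpha<\dfrac1{\pi_0S(n_0)}.\end{cases}$$
   Context: The $p$-values $p_1,\dots,p_n$ are $[0,1]$-valued random variables on a common probability space. A fixed subset $\mathcal N_0\subset\{1,\dots,n\}$ of size $n_0\ge1$ indexes the true null hypotheses; the corresponding $p$-values are the null $p$-values, each stochastically larger than or equal to the uniform variable on $(0,1)$. A multiple testing procedure (measurably) outputs a set of rejected $p$-values. With $R$ the number of rejections and $V$ the number of rejected null $p$-values, $\mathrm{FDR}=\mathbb E[V/\max\{R,1\}]$. The procedure is compliant at level $\alpha$ if every rejected $p$-value $p_j$ satisfies $p_j\le\alpha R/n$. *)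

theory Defs
  imports "HOL-Probability.Probability" "HOL-Analysis.Harmonic_Numbers"
begin

text \<open>Usual stochastic order: the first law is stochastically larger than or equal to
  the second.\<close>
definition stoch_ge :: "real measure \<Rightarrow> real measure \<Rightarrow> bool" where
  "stoch_ge \<mu> \<nu> \<longleftrightarrow> (\<forall>t. cdf \<mu> t \<le> cdf \<nu> t)"

definition p_values :: "'a measure \<Rightarrow> nat \<Rightarrow> (nat \<Rightarrow> 'a \<Rightarrow> real) \<Rightarrow> bool" where
  "p_values M n p \<longleftrightarrow>
     (\<forall>i\<in>{1..n}. p i \<in> borel_measurable M \<and> (\<forall>\<omega>\<in>space M. p i \<omega> \<in> {0..1}))"

definition null_p_value :: "'a measure \<Rightarrow> ('a \<Rightarrow> real) \<Rightarrow> bool" where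
  "null_p_value M q \<longleftrightarrow> stoch_ge (distr M borel q) (uniform_measure lborel {0<..<1})"

text \<open>A procedure is represented by its random set of rejected indices. The set need not be a
  function of the p-values alone, so randomization and side information are allowed. A procedure
  \<open>\<phi>\<close> acting on the vector of p-values corresponds to \<open>Rej \<omega> = \<phi> (\<lambda>i. p i \<omega>)\<close>.\<close>
definition procedure :: "'a measure \<Rightarrow> nat \<Rightarrow> ('a \<Rightarrow> nat set) \<Rightarrow> bool" where
  "procedure M n Rej \<longleftrightarrow> Rej \<in> M \<rightarrow>\<^sub>M count_space (Pow {1..n})"

definition num_rej :: "('a \<Rightarrow> nat set) \<Rightarrow> 'a \<Rightarrow> nat" where
  "num_rej Rej \<omega> = card (Rej \<omega>)"

definition num_null_rej :: "nat set \<Rightarrow> ('a \<Rightarrow> nat set) \<Rightarrow> 'a \<Rightarrow> nat" where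
  "num_null_rej N0 Rej \<omega> = card (Rej \<omega> \<inter> N0)"

definition FDR :: "'a measure \<Rightarrow> nat set \<Rightarrow> ('a \<Rightarrow> nat set) \<Rightarrow> real" where
  "FDR M N0 Rej =
     (LINT \<omega>|M. real (num_null_rej N0 Rej \<omega>) / real (max (num_rej Rej \<omega>) 1))"

definition compliant ::
  "'a measure \<Rightarrow> nat \<Rightarrow> (nat \<Rightarrow> 'a \<Rightarrow> real) \<Rightarrow> real \<Rightarrow> ('a \<Rightarrow> nat set) \<Rightarrow> bool" where
  "compliant M n p \<alpha> Rej \<longleftrightarrow>
     (\<forall>\<omega>\<in>space M. \<forall>j\<in>Rej \<omega>. p j \<omega> \<le> \<alpha> * real (num_rej Rej \<omega>) / real n)"

end

theory Submission
  imports Defs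
begin

text \<open>If \<open>V / max R 1 \<ge> t > 0\<close>, compliance puts \<open>j = V\<close> null p-values below
  \<open>\<alpha> R / n \<le> j x / n0\<close> with \<open>x = \<pi>0 \<alpha> / t\<close>: the Simes test of the nulls rejects at
  level \<open>x\<close>. By Hommel's inequality this has probability at most \<open>S(n0) x\<close> under any dependence,
  so the false discovery proportion has tails at most \<open>min 1 (c / t)\<close> with \<open>c = S(n0) \<pi>0 \<alpha>\<close>,
  and integrating over \<open>t \<in> [0, 1]\<close> gives \<open>c + c ln (1 / c)\<close>.\<close>

text \<open>Fubini for the indicator of the region \<open>0 \<le> t \<le> X \<omega>\<close>: its
  slice at fixed \<open>\<omega>\<close> is an interval of length \<open>X \<omega>\<close>, its
  slice at fixed \<open>t\<close> is a tail event. Since \<open>X \<le> 1\<close>, tails beyond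
  \<open>t = 1\<close> are empty, which confines the integral to \<open>{0..1}\<close>.\<close>

lemma nn_integral_layer_cake_unit:
  assumes "prob_space M" and [measurable]: "X \<in> borel_measurable M"
    and X: "\<And>\<omega>. \<omega> \<in> space M \<Longrightarrow> 0 \<le> X \<omega> \<and> X \<omega> \<le> (1::real)"
  shows "(\<integral>\<^sup>+\<omega>. ennreal (X \<omega>) \<partial>M) =
    (\<integral>\<^sup>+t. emeasure M {\<omega> \<in> space M. t \<le> X \<omega>} * indicator {0..1} t \<partial>lborel)"
proof -
  interpret prob_space M by fact
  interpret P: pair_sigma_finite lborel M ..
  have "(\<integral>\<^sup>+\<omega>. ennreal (X \<omega>) \<partial>M) =
      (\<integral>\<^sup>+\<omega>. (\<integral>\<^sup>+t. indicator {p. 0 \<le> fst p \<and> fst p \<le> X (snd p)} (t, \<omega>) \<partial>lborel) \<partial>M)"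
  proof (rule nn_integral_cong)
    fix \<omega> assume w: "\<omega> \<in> space M"
    have "(\<integral>\<^sup>+t. indicator {p. 0 \<le> fst p \<and> fst p \<le> X (snd p)} (t, \<omega>) \<partial>lborel) =
        (\<integral>\<^sup>+t. indicator {0..X \<omega>} t \<partial>lborel)"
      by (intro nn_integral_cong) (auto simp: indicator_def)
    also have "\<dots> = ennreal (X \<omega>)" using X[OF w] by simp
    finally show "ennreal (X \<omega>) =
        (\<integral>\<^sup>+t. indicator {p. 0 \<le> fst p \<and> fst p \<le> X (snd p)} (t, \<omega>) \<partial>lborel)" by simp
  qed
  also have "\<dots> =
      (\<integral>\<^sup>+t. (\<integral>\<^sup>+\<omega>. indicator {p. 0 \<le> fst p \<and> fst p \<le> X (snd p)} (t, \<omega>) \<partial>M) \<partial>lborel)"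
    by (rule P.Fubini'[of "\<lambda>t \<omega>. indicator {p. 0 \<le> fst p \<and> fst p \<le> X (snd p)} (t, \<omega>)"])
       (simp add: indicator_def case_prod_beta)
  also have "\<dots> =
      (\<integral>\<^sup>+t. emeasure M {\<omega> \<in> space M. t \<le> X \<omega>} * indicator {0..1} t \<partial>lborel)"
  proof (rule nn_integral_cong)
    fix t :: real
    have "(\<integral>\<^sup>+\<omega>. indicator {p. 0 \<le> fst p \<and> fst p \<le> X (snd p)} (t, \<omega>) \<partial>M) =
        (\<integral>\<^sup>+\<omega>. indicator {0..1} t * indicator {\<omega> \<in> space M. t \<le> X \<omega>} \<omega> \<partial>M)"
      using X by (intro nn_integral_cong) (force simp: indicator_def)
    also have "\<dots> = emeasure M {\<omega> \<in> space M. t \<le> X \<omega>} * indicator {0..1} t"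
      by (subst nn_integral_cmult_indicator) (auto simp: mult.commute)
    finally show "(\<integral>\<^sup>+\<omega>. indicator {p. 0 \<le> fst p \<and> fst p \<le> X (snd p)} (t, \<omega>) \<partial>M) =
        emeasure M {\<omega> \<in> space M. t \<le> X \<omega>} * indicator {0..1} t" .
  qed
  finally show ?thesis .
qed

text \<open>The bound \<open>c / t\<close> beats the trivial bound 1 only for \<open>t > c\<close>.
  Using 1 on \<open>{0..c}\<close> and \<open>c / t\<close> on \<open>{c..1}\<close> gives
  \<open>c - c * ln c\<close>; \<open>c \<le> 1\<close> places the split point inside the unit
  interval.\<close>

lemma expectation_le_of_inverse_tail:
  assumes "prob_space M" and [measurable]: "X \<in> borel_measurable M"
    and X: "\<And>\<omega>. \<omega> \<in> space M \<Longrightarrow> 0 \<le> X \<omega> \<and> X \<omega> \<le> (1::real)"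
    and c: "0 < c" "c \<le> 1"
    and tail: "\<And>t. 0 < t \<Longrightarrow> measure M {\<omega> \<in> space M. t \<le> X \<omega>} \<le> c / t"
  shows "(LINT \<omega>|M. X \<omega>) \<le> c * ln (exp 1 / c)"
proof -
  interpret prob_space M by fact
  have int: "integrable M X"
    using X by (intro integrable_const_bound[where B=1]) auto
  have "ennreal (LINT \<omega>|M. X \<omega>) = (\<integral>\<^sup>+\<omega>. ennreal (X \<omega>) \<partial>M)"
    using X by (subst nn_integral_eq_integral[OF int]) auto
  also have "\<dots> = (\<integral>\<^sup>+t. emeasure M {\<omega> \<in> space M. t \<le> X \<omega>} * indicator {0..1} t \<partial>lborel)"
    by (rule nn_integral_layer_cake_unit) fact+
  also have "\<dots> \<le>
      (\<integral>\<^sup>+t. indicator {0..c} t + ennreal (c / t) * indicator {c..1} t \<partial>lborel)"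
  proof (rule nn_integral_mono)
    fix t :: real
    have le_one: "emeasure M {\<omega> \<in> space M. t \<le> X \<omega>} \<le> 1" by (rule emeasure_le_1)
    have le_tail: "emeasure M {\<omega> \<in> space M. t \<le> X \<omega>} \<le> ennreal (c / t)" if "0 < t"
      using tail[OF that] by (simp add: emeasure_eq_measure ennreal_leI)
    show "emeasure M {\<omega> \<in> space M. t \<le> X \<omega>} * indicator {0..1} t \<le>
        indicator {0..c} t + ennreal (c / t) * indicator {c..1} t"
      using le_one le_tail c by (auto simp: indicator_def add_increasing2)
  qed
  also have "\<dots> = ennreal c + ennreal (c * ln 1 - c * ln c)"
  proof -
    \<comment> \<open>The value is left as a difference of the antiderivative
      \<open>c * ln t\<close> at the endpoints 1 and \<open>c\<close>.\<close>
    have "(\<integral>\<^sup>+t. ennreal (c / t) * indicator {c..1} t \<partial>lborel) = ennreal (c * ln 1 - c * ln c)"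
      using c by (intro nn_integral_FTC_Icc) (auto intro!: derivative_eq_intros)
    then show ?thesis
      using c by (subst nn_integral_add) auto
  qed
  also have "\<dots> = ennreal (c * ln (exp 1 / c))"
    using c by (subst ennreal_plus[symmetric])
      (auto simp: ln_div algebra_simps mult_nonneg_nonpos)
  \<comment> \<open>Returning from \<open>ennreal\<close> to the reals needs a nonnegative
    right-hand side: \<open>ln c \<le> 0 \<le> 1\<close> gives
    \<open>c * (1 - ln c) \<ge> 0\<close>.\<close>
  finally show ?thesis
    using c order.trans[OF ln_le_zero_iff[THEN iffD2, of c] zero_le_one]
    by (subst (asm) ennreal_le_iff) (auto simp: ln_div intro!: mult_nonneg_nonneg)
qed

text \<open>Telescoping by partial fractions. These summands become the coefficients of the random
  weights in Hommel's inequality.\<close>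

lemma sum_inverse_consecutive:
  assumes "1 \<le> j" "j \<le> m"
  shows "(\<Sum>k=j..<m. 1 / (real k * real (k + 1))) = 1 / real j - 1 / real m"
  using assms(2)
proof (induction m rule: dec_induct)
  case (step m)
  have "1 / (real m * real (m + 1)) = 1 / real m - 1 / real (Suc m)"
    using assms(1) step.hyps by (simp add: field_simps)
  then show ?case using step by simp
qed simp

lemma sum_inverse_Suc_eq_harm:
  assumes "1 \<le> m"
  shows "(\<Sum>k=1..<m. 1 / real (k + 1)) = harm m - 1"
  using assms
proof (induction m rule: dec_induct)
  case (step m)
  then show ?case by (simp add: harm_Suc inverse_eq_divide)
qed (simp add: harm_def)

text \<open>Each index \<open>i\<close> gets a nonnegative random weight that depends on
  \<open>q i\<close> alone, and on \<open>A\<close> the weights sum to at least 1. Hence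
  \<open>prob A\<close> is at most the sum of the mean weights, and each mean involves only the
  marginal law of \<open>q i\<close>, so the dependence between the \<open>q i\<close> is
  irrelevant.\<close>

lemma (in prob_space) hommel_inequality:
  fixes q :: "'i \<Rightarrow> 'a \<Rightarrow> real"
  assumes I: "finite I" "I \<noteq> {}"
    and q[measurable]: "\<And>i. i \<in> I \<Longrightarrow> q i \<in> borel_measurable M"
    and unif: "\<And>i y. i \<in> I \<Longrightarrow> 0 \<le> y \<Longrightarrow> prob {\<omega> \<in> space M. q i \<omega> \<le> y} \<le> y"
    and x: "0 \<le> x"
    and A: "A \<in> events"
    and simes: "\<And>\<omega>. \<omega> \<in> A \<Longrightarrow> \<exists>j\<in>{1..card I}.
      j \<le> card {i \<in> I. q i \<omega> \<le> real j * x / real (card I)}"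
  shows "prob A \<le> harm (card I) * x"
proof -
  define m where "m = card I"
  have m: "1 \<le> m" using I by (simp add: m_def Suc_le_eq card_gt_0_iff)
  define E where "E i k = {\<omega> \<in> space M. q i \<omega> \<le> real k * x / real m}" for i k
  have E[measurable]: "E i k \<in> events" if "i \<in> I" for i k
    using q[OF that] unfolding E_def by measurable
  \<comment> \<open>The weights telescope to \<open>w i \<ge> 1 / j\<close> on \<open>E i j\<close>, so that \<open>j\<close> indices suffice to sum to \<open>1\<close>.\<close>
  define w where "w i \<omega> = 1 / real m * indicator (E i m) \<omega> +
    (\<Sum>k=1..<m. 1 / (real k * real (k + 1)) * indicator (E i k) \<omega>)" for i \<omega>
  have w_nonneg: "0 \<le> w i \<omega>" for i \<omega>
    unfolding w_def by (intro add_nonneg_nonneg sum_nonneg) auto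
  have w_ge: "1 / real j \<le> w i \<omega>" if j: "1 \<le> j" "j \<le> m" and w: "\<omega> \<in> E i j" for i j \<omega>
  proof -
    \<comment> \<open>As \<open>x \<ge> 0\<close>, the events \<open>E i k\<close> increase with
      \<open>k\<close>, so every term from level \<open>j\<close> on is switched on.\<close>
    have in_E: "\<omega> \<in> E i k" if "j \<le> k" for k
    proof -
      have "real j * x / real m \<le> real k * x / real m"
        using that x by (intro divide_right_mono mult_right_mono) auto
      then show ?thesis using w by (auto simp: E_def)
    qed
    have "1 / real j = 1 / real m + (\<Sum>k=j..<m. 1 / (real k * real (k + 1)))"
      using sum_inverse_consecutive[OF j] by simp
    also have "(\<Sum>k=j..<m. 1 / (real k * real (k + 1))) =
        (\<Sum>k=j..<m. 1 / (real k * real (k + 1)) * indicator (E i k) \<omega>)"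
      using in_E by (intro sum.cong) auto
    also have "\<dots> \<le> (\<Sum>k=1..<m. 1 / (real k * real (k + 1)) * indicator (E i k) \<omega>)"
      using j by (intro sum_mono2) auto
    finally show ?thesis using in_E[OF j(2)] by (simp add: w_def)
  qed
  have w_int: "integrable M (w i)" if "i \<in> I" for i
    unfolding w_def using E[OF that] by (auto simp: emeasure_eq_measure)
  have w_mean: "expectation (w i) \<le> harm m * x / real m" if i: "i \<in> I" for i
  proof -
    have prob_E: "prob (E i k) \<le> real k * x / real m" for k
      unfolding E_def using x by (intro unif[OF i]) auto
    have "expectation (w i) = 1 / real m * prob (E i m) +
        (\<Sum>k=1..<m. 1 / (real k * real (k + 1)) * prob (E i k))"
      unfolding w_def using E[OF i]
      by (subst Bochner_Integration.integral_add)
         (auto simp: emeasure_eq_measure Bochner_Integration.integral_sum)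
    also have "\<dots> \<le> 1 / real m * (real m * x / real m) +
        (\<Sum>k=1..<m. 1 / (real k * real (k + 1)) * (real k * x / real m))"
      by (intro add_mono sum_mono mult_left_mono prob_E) auto
    \<comment> \<open>The factor \<open>k\<close> from the probability cancels against the
      coefficient and leaves \<open>1 / (k + 1)\<close>. This sum starts at 1/2; the top level
      \<open>m\<close> supplies the missing term 1 of \<open>harm m\<close>.\<close>
    also have "\<dots> = x / real m + (\<Sum>k=1..<m. 1 / real (k + 1)) * (x / real m)"
      using m unfolding sum_distrib_right
      by (intro arg_cong2[where f="(+)"] sum.cong) (auto simp: divide_simps)
    also have "\<dots> = harm m * x / real m"
      unfolding sum_inverse_Suc_eq_harm[OF m]
      by (simp add: algebra_simps diff_divide_distrib)
    finally show ?thesis .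
  qed
  have ge_one: "indicator A \<omega> \<le> (\<Sum>i\<in>I. w i \<omega>)" for \<omega>
  proof (cases "\<omega> \<in> A")
    case True
    then have sp: "\<omega> \<in> space M" using sets.sets_into_space[OF A] by auto
    obtain j where j: "1 \<le> j" "j \<le> m"
      and "j \<le> card {i \<in> I. q i \<omega> \<le> real j * x / real m}"
      using simes[OF True] by (auto simp: m_def)
    \<comment> \<open>At least \<open>j\<close> indices lie below the level belonging to
      \<open>j\<close>, and each contributes \<open>1 / j\<close>.\<close>
    then have "1 \<le> (\<Sum>i | i \<in> I \<and> q i \<omega> \<le> real j * x / real m. 1 / real j)"
      by (simp add: field_simps)
    also have "\<dots> \<le> (\<Sum>i | i \<in> I \<and> q i \<omega> \<le> real j * x / real m. w i \<omega>)"
      using j sp by (intro sum_mono w_ge) (auto simp: E_def)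
    also have "\<dots> \<le> (\<Sum>i\<in>I. w i \<omega>)"
      using I w_nonneg by (intro sum_mono2) auto
    finally show ?thesis by (simp add: indicator_def)
  qed (simp add: sum_nonneg w_nonneg)
  have "prob A = expectation (indicator A)" using A by simp
  also have "\<dots> \<le> expectation (\<lambda>\<omega>. \<Sum>i\<in>I. w i \<omega>)"
    using A w_int ge_one by (intro integral_mono) (auto simp: emeasure_eq_measure)
  also have "\<dots> = (\<Sum>i\<in>I. expectation (w i))"
    using w_int by (intro Bochner_Integration.integral_sum) auto
  also have "\<dots> \<le> (\<Sum>i\<in>I. harm m * x / real m)" by (intro sum_mono w_mean)
  also have "\<dots> = harm (card I) * x" using m by (simp add: m_def)
  finally show ?thesis .
qed

lemma null_p_value_prob_le:
  assumes "prob_space M" and q: "q \<in> borel_measurable M"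
    and null: "null_p_value M q" and y: "0 \<le> y"
  shows "measure M {\<omega> \<in> space M. q \<omega> \<le> y} \<le> y"
proof -
  have "measure M {\<omega> \<in> space M. q \<omega> \<le> y} = cdf (distr M borel q) y"
    using q by (auto simp: cdf_def measure_distr vimage_def Int_def
        intro!: arg_cong[of _ _ "measure M"])
  also have "\<dots> \<le> cdf (uniform_measure lborel {0<..<1}) y"
    using null by (simp add: null_p_value_def stoch_ge_def)
  also have "\<dots> = measure lborel ({0<..<1} \<inter> {..y})"
    by (simp add: cdf_def measure_uniform_measure)
  \<comment> \<open>Enlarging to \<open>{0..y}\<close> also covers \<open>y > 1\<close>, which
    occurs because the Simes level grows without bound as \<open>t\<close> tends to 0.\<close>
  also have "\<dots> \<le> measure lborel {0..y}"
    by (intro measure_mono_fmeasurable) (auto simp: fmeasurable_def y)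
  also have "\<dots> = y" using y by simp
  finally show ?thesis .
qed

theorem theorem7:
  fixes M :: "'a measure"
    and n n0 :: nat
    and N0 :: "nat set"
    and p :: "nat \<Rightarrow> 'a \<Rightarrow> real"
    and \<alpha> \<pi>0 :: real
    and Rej :: "'a \<Rightarrow> nat set"
  assumes "prob_space M"
    and "p_values M n p"
    and "N0 \<subseteq> {1..n}"
    and "card N0 = n0"
    and "n0 \<ge> 1"
    and "\<And>i. i \<in> N0 \<Longrightarrow> null_p_value M (p i)"
    and "\<pi>0 = real n0 / real n"
    and "0 < \<alpha>"
    and "\<alpha> < 1"
    and "procedure M n Rej"
    and "compliant M n p \<alpha> Rej"
  shows "FDR M N0 Rej \<le>
    (if \<alpha> \<ge> 1 / (\<pi>0 * harm n0) then 1
     else harm n0 * \<pi>0 * \<alpha> * ln (exp 1 / (harm n0 * \<pi>0 * \<alpha>)))"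
proof -
  interpret prob_space M by fact
  define Z where "Z \<omega> = real (num_null_rej N0 Rej \<omega>) / real (max (num_rej Rej \<omega>) 1)" for \<omega>
  have FDR: "FDR M N0 Rej = expectation Z" unfolding FDR_def Z_def ..
  have N0: "finite N0" "N0 \<noteq> {}" using assms(3-5) finite_subset by auto
  have "n0 \<le> n" using card_mono[OF _ assms(3)] assms(4) by simp
  then have n: "1 \<le> n" using assms(5) by simp
  have Rej_meas: "Rej \<in> M \<rightarrow>\<^sub>M count_space (Pow {1..n})"
    using assms(10) by (simp add: procedure_def)
  \<comment> \<open>The false discovery proportion is a function of the rejected set, and every
    function on a discrete space is measurable.\<close>
  have "(\<lambda>r. real (card (r \<inter> N0)) / real (max (card r) 1)) \<circ> Rej \<in> borel_measurable M"
    by (rule measurable_comp[OF Rej_meas]) simp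
  then have Z_meas[measurable]: "Z \<in> borel_measurable M"
    by (simp add: Z_def[abs_def] num_null_rej_def num_rej_def comp_def)
  have Rej_fin: "finite (Rej \<omega>)" if "\<omega> \<in> space M" for \<omega>
    using measurable_space[OF Rej_meas that] by (auto intro: finite_subset)
  have Z: "0 \<le> Z \<omega> \<and> Z \<omega> \<le> 1" if "\<omega> \<in> space M" for \<omega>
    using card_mono[OF Rej_fin[OF that], of "Rej \<omega> \<inter> N0"]
    by (auto simp: Z_def num_null_rej_def num_rej_def divide_le_eq_1)
  define c where "c = harm n0 * \<pi>0 * \<alpha>"
  have "0 < harm n0 * \<pi>0"
    using assms(5,7) n by (auto intro!: mult_pos_pos harm_pos)
  \<comment> \<open>The case distinction of the theorem is whether \<open>c\<close> reaches
    1.\<close>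
  then have c: "0 < c" and split: "\<alpha> \<ge> 1 / (\<pi>0 * harm n0) \<longleftrightarrow> 1 \<le> c"
    using assms(8) by (auto simp: c_def field_simps)
  have "measure M {\<omega> \<in> space M. t \<le> Z \<omega>} \<le> c / t" if t: "0 < t" for t
  proof -
    have "prob {\<omega> \<in> space M. t \<le> Z \<omega>} \<le> harm (card N0) * (\<pi>0 * \<alpha> / t)"
    proof (rule hommel_inequality[OF N0])
      show meas: "p i \<in> borel_measurable M" if "i \<in> N0" for i
        using assms(2,3) that by (auto simp: p_values_def)
      show "prob {\<omega> \<in> space M. p i \<omega> \<le> y} \<le> y" if "i \<in> N0" "0 \<le> y" for i y
        using null_p_value_prob_le[OF assms(1) meas assms(6)] that by blast
      show "0 \<le> \<pi>0 * \<alpha> / t" using assms(7,8) t by simp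
      show "{\<omega> \<in> space M. t \<le> Z \<omega>} \<in> events" by measurable
      fix \<omega> assume "\<omega> \<in> {\<omega> \<in> space M. t \<le> Z \<omega>}"
      then have w: "\<omega> \<in> space M" and tZ: "t \<le> Z \<omega>" by auto
      \<comment> \<open>The Simes witness is the number of false rejections; it is nonzero because
        \<open>Z \<omega> \<ge> t > 0\<close>.\<close>
      define j where "j = card (Rej \<omega> \<inter> N0)"
      define R where "R = card (Rej \<omega>)"
      have "j \<noteq> 0" using tZ t by (auto simp: Z_def num_null_rej_def j_def intro: ccontr)
      moreover have "j \<le> card N0" unfolding j_def by (intro card_mono N0) auto
      moreover have "Rej \<omega> \<inter> N0 \<subseteq> {i \<in> N0. p i \<omega> \<le> real j * (\<pi>0 * \<alpha> / t) / real (card N0)}"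
      proof safe
        fix i assume i: "i \<in> Rej \<omega>" "i \<in> N0"
        \<comment> \<open>Since \<open>i\<close> is rejected, the maximum in the denominator is
          \<open>R\<close> itself, so \<open>t \<le> Z \<omega>\<close> reads
          \<open>t * R \<le> j\<close>. This replaces the random threshold
          \<open>\<alpha> * R / n\<close> by one depending on \<open>j\<close> only.\<close>
        have "1 \<le> R" using i Rej_fin[OF w] by (auto simp: R_def Suc_le_eq card_gt_0_iff)
        then have "t * real R \<le> real j"
          using tZ by (simp add: Z_def num_null_rej_def num_rej_def flip: j_def R_def)
            (simp add: field_simps max_def)
        then have R: "real R \<le> real j / t" using t by (simp add: field_simps)
        have "p i \<omega> \<le> \<alpha> * real R / real n"
          using assms(11) w i by (auto simp: compliant_def num_rej_def R_def)
        also have "\<dots> \<le> \<alpha> * (real j / t) / real n"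
          using assms(8) R by (intro divide_right_mono mult_left_mono) auto
        \<comment> \<open>Here \<open>\<pi>0 / n0 = 1 / n\<close> rescales the threshold from all
          \<open>n\<close> hypotheses to the \<open>n0\<close> nulls.\<close>
        also have "\<dots> = real j * (\<pi>0 * \<alpha> / t) / real (card N0)"
          using assms(4,5,7) by (simp add: field_simps)
        finally show "p i \<omega> \<le> real j * (\<pi>0 * \<alpha> / t) / real (card N0)" .
      qed
      then have "j \<le> card {i \<in> N0. p i \<omega> \<le> real j * (\<pi>0 * \<alpha> / t) / real (card N0)}"
        unfolding j_def using N0 by (intro card_mono) auto
      ultimately show "\<exists>j\<in>{1..card N0}.
          j \<le> card {i \<in> N0. p i \<omega> \<le> real j * (\<pi>0 * \<alpha> / t) / real (card N0)}"
        by (intro bexI[of _ j]) auto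
    qed
    then show ?thesis using assms(4) by (simp add: c_def mult.assoc)
  qed
  \<comment> \<open>The logarithmic bound serves the branch \<open>c < 1\<close>; for
    \<open>c \<ge> 1\<close> the trivial bound \<open>Z \<le> 1\<close> is enough.\<close>
  then have "expectation Z \<le> c * ln (exp 1 / c)" if "c \<le> 1"
    using expectation_le_of_inverse_tail[OF assms(1) Z_meas Z c that] by blast
  moreover have "expectation Z \<le> 1"
    using Z by (intro integral_le_const integrable_const_bound[where B=1]) auto
  ultimately show ?thesis
    unfolding FDR split c_def[symmetric] by auto
qed

end
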